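(* Let $R_1,R_2$ be $\mathcal{R}$-cross-sections of the semigroup $\mathcal{IS}_n$ and let $\varphi\colon R_1\to R_2$ be a semigroup isomorphism. Then there exists an element $\Theta\in\mathcal{S}_n$ such that for every $\alpha\in R_1$ and every $x\in\{1,\dots,n\}$ the equality $$x\,\alpha\,\Theta = x\,\Theta\,\varphi(\alpha)$$ holds.
   Context: $n$ is a positive integer. $\mathcal{IS}_n$ is the finite inverse symmetric semigroup: the set of all partial bijections of $\{1,\dots,n\}$ (injective maps from a subset of $\{1,\dots,n\}$ to $\{1,\dots,n\}$, including the empty map), with maps written on the right and composed from left to right: $x(ab)=(xa)b$, $\operatorname{dom}(ab)=\{x\in\operatorname{dom}(a): xa\in\operatorname{dom}(b)\}$. $\mathcal{S}_n$ is the symmetric group on $\{1,\dots,n\}$. Equalities between values of partial maps mean that either both sides are defined and equal or both sides are undefined. Green's relation $\mathcal{R}$ on an inverse semigroup $S$ with identity is $a\,\mathcal{R}\,b\Leftrightarrow aS=bS$; on $\mathcal{IS}_n$ this is equivalent to $\operatorname{dom}(a)=\operatorname{dom}(b)$. An $\mathcal{R}$-cross-section of $S$ is a subsemigroup of $S$ containing exactly one element from each $\mathcal{R}$-class. *)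

theory Defs
  imports "HOL-Algebra.Coset" "HOL-Combinatorics.Permutations"
begin

text \<open>Partial bijections are maps \<^typ>\<open>nat \<rightharpoonup> nat\<close>. Maps are written on the right and
  composed from left to right, so the product of \<open>a\<close> and \<open>b\<close> (first \<open>a\<close>, then \<open>b\<close>) is
  \<open>b \<circ>\<^sub>m a\<close>.\<close>

definition IS :: "nat \<Rightarrow> (nat \<rightharpoonup> nat) monoid" where
  "IS n = \<lparr>carrier = {a. dom a \<subseteq> {1..n} \<and> ran a \<subseteq> {1..n} \<and> inj_on a (dom a)},
           monoid.mult = (\<lambda>a b. b \<circ>\<^sub>m a),
           one = (\<lambda>x. if x \<in> {1..n} then Some x else None)\<rparr>"

definition green_R :: "('a, 'm) monoid_scheme \<Rightarrow> ('a \<times> 'a) set" where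
  "green_R S = {(a, b). a \<in> carrier S \<and> b \<in> carrier S \<and>
                        a <#\<^bsub>S\<^esub> carrier S = b <#\<^bsub>S\<^esub> carrier S}"

definition subsemigroup :: "'a set \<Rightarrow> ('a, 'm) monoid_scheme \<Rightarrow> bool" where
  "subsemigroup T S \<longleftrightarrow> T \<noteq> {} \<and> T \<subseteq> carrier S \<and> (\<forall>a\<in>T. \<forall>b\<in>T. a \<otimes>\<^bsub>S\<^esub> b \<in> T)"

definition R_cross_section :: "'a set \<Rightarrow> ('a, 'm) monoid_scheme \<Rightarrow> bool" where
  "R_cross_section T S \<longleftrightarrow>
     subsemigroup T S \<and> (\<forall>C \<in> carrier S // green_R S. \<exists>!a. a \<in> T \<inter> C)"

lemma IS_carrier_iff:
  "a \<in> carrier (IS n) \<longleftrightarrow> dom a \<subseteq> {1..n} \<and> ran a \<subseteq> {1..n} \<and> inj_on a (dom a)"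
  by (simp add: IS_def)

lemma IS_mult: "a \<otimes>\<^bsub>IS n\<^esub> b = b \<circ>\<^sub>m a"
  by (simp add: IS_def)

lemma IS_one: "\<one>\<^bsub>IS n\<^esub> = (\<lambda>x. if x \<in> {1..n} then Some x else None)"
  by (simp add: IS_def)

lemma IS_mult_closed:
  assumes "a \<in> carrier (IS n)" "b \<in> carrier (IS n)"
  shows "b \<circ>\<^sub>m a \<in> carrier (IS n)"
proof -
  have "dom (b \<circ>\<^sub>m a) \<subseteq> dom a" "ran (b \<circ>\<^sub>m a) \<subseteq> ran b"
    by (auto simp: map_comp_Some_iff ran_def)
  moreover have "inj_on (b \<circ>\<^sub>m a) (dom (b \<circ>\<^sub>m a))"
  proof (rule inj_onI)
    fix x y assume "x \<in> dom (b \<circ>\<^sub>m a)" and eq: "(b \<circ>\<^sub>m a) x = (b \<circ>\<^sub>m a) y"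
    then obtain z where "(b \<circ>\<^sub>m a) x = Some z" "(b \<circ>\<^sub>m a) y = Some z"
      by (metis domD)
    then obtain u v where uv: "a x = Some u" "b u = Some z" "a y = Some v" "b v = Some z"
      by (auto simp: map_comp_Some_iff)
    then have "u = v"
      using inj_onD[of b "dom b" u v] assms(2) by (simp add: IS_carrier_iff domI)
    then show "x = y"
      using uv inj_onD[of a "dom a" x y] assms(1) by (simp add: IS_carrier_iff domI)
  qed
  ultimately show ?thesis
    using assms unfolding IS_carrier_iff by (meson order_trans)
qed

lemma monoid_IS: "monoid (IS n)"
proof
  show "\<one>\<^bsub>IS n\<^esub> \<in> carrier (IS n)"
    unfolding IS_carrier_iff IS_one dom_def ran_def inj_on_def by (simp split: if_split_asm) auto
next
  fix a assume a: "a \<in> carrier (IS n)"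
  show "\<one>\<^bsub>IS n\<^esub> \<otimes>\<^bsub>IS n\<^esub> a = a"
  proof
    fix x
    have "a x = None" if "x \<notin> {1..n}"
      using a that unfolding IS_carrier_iff by blast
    then show "(\<one>\<^bsub>IS n\<^esub> \<otimes>\<^bsub>IS n\<^esub> a) x = a x"
      unfolding IS_mult IS_one map_comp_def by simp
  qed
  show "a \<otimes>\<^bsub>IS n\<^esub> \<one>\<^bsub>IS n\<^esub> = a"
  proof
    fix x
    have "y \<in> {1..n}" if "a x = Some y" for y
      using a ranI[of a, OF that] unfolding IS_carrier_iff by blast
    then show "(a \<otimes>\<^bsub>IS n\<^esub> \<one>\<^bsub>IS n\<^esub>) x = a x"
      unfolding IS_mult IS_one map_comp_def by (simp split: option.split)
  qed
qed (simp_all only: IS_mult IS_mult_closed, simp add: map_comp_def fun_eq_iff split: option.split)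

lemma IS_dom_eqD:
  assumes a: "a \<in> carrier (IS n)" and b: "b \<in> carrier (IS n)" and d: "dom a = dom b"
  shows "a <#\<^bsub>IS n\<^esub> carrier (IS n) \<subseteq> b <#\<^bsub>IS n\<^esub> carrier (IS n)"
proof -
  define c where "c y = (if y \<in> ran b then a (THE x. b x = Some y) else None)" for y
  have the: "(THE x. b x = Some y) = x" if "b x = Some y" for x y
    using that b unfolding IS_carrier_iff inj_on_def by (intro the_equality) (auto simp: dom_def)
  have c: "c y = a x" if "b x = Some y" for x y
    using that the by (auto simp: c_def ran_def)
  have cD: "\<exists>x. b x = Some y \<and> a x = Some z" if "c y = Some z" for y z
    using that the by (auto simp: c_def ran_def split: if_splits)
  have "a = c \<circ>\<^sub>m b"
  proof
    fix x
    show "a x = (c \<circ>\<^sub>m b) x"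
    proof (cases "b x")
      case None
      then show ?thesis using d by (metis domIff map_comp_simps(1))
    next
      case (Some y)
      then show ?thesis using c by simp
    qed
  qed
  moreover have "c \<in> carrier (IS n)"
    unfolding IS_carrier_iff
  proof (intro conjI inj_onI)
    show "dom c \<subseteq> {1..n}"
    proof
      fix y assume "y \<in> dom c"
      then obtain x where "b x = Some y" using cD by auto
      then show "y \<in> {1..n}" using b ranI[of b x y] unfolding IS_carrier_iff by blast
    qed
    show "ran c \<subseteq> {1..n}"
    proof
      fix z assume "z \<in> ran c"
      then obtain x where "a x = Some z" using cD by (auto simp: ran_def)
      then show "z \<in> {1..n}" using a ranI[of a x z] unfolding IS_carrier_iff by blast
    qed
    fix x y assume "x \<in> dom c" and eq: "c x = c y"
    then obtain z where "c x = Some z" "c y = Some z" by (metis domD)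
    then obtain u v where uv: "b u = Some x" "b v = Some y" "a u = Some z" "a v = Some z"
      using cD by meson
    then have "u = v"
      using inj_onD[of a "dom a" u v] a by (simp add: IS_carrier_iff domI)
    then show "x = y" using uv by simp
  qed
  ultimately have ac: "a = b \<otimes>\<^bsub>IS n\<^esub> c" and cc: "c \<in> carrier (IS n)"
    by (simp_all only: IS_mult)
  show ?thesis
  proof
    fix t assume "t \<in> a <#\<^bsub>IS n\<^esub> carrier (IS n)"
    then obtain s where s: "s \<in> carrier (IS n)" "t = a \<otimes>\<^bsub>IS n\<^esub> s"
      unfolding l_coset_def by blast
    then have "t = b \<otimes>\<^bsub>IS n\<^esub> (c \<otimes>\<^bsub>IS n\<^esub> s)"
      using ac monoid.m_assoc[OF monoid_IS b cc s(1)] by simp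
    moreover have "c \<otimes>\<^bsub>IS n\<^esub> s \<in> carrier (IS n)"
      by (rule monoid.m_closed[OF monoid_IS cc s(1)])
    ultimately show "t \<in> b <#\<^bsub>IS n\<^esub> carrier (IS n)"
      unfolding l_coset_def by blast
  qed
qed

lemma green_R_IS:
  "green_R (IS n) = {(a, b). a \<in> carrier (IS n) \<and> b \<in> carrier (IS n) \<and> dom a = dom b}"
proof -
  have *: "dom a \<subseteq> dom b"
    if "a \<in> carrier (IS n)"
      "a <#\<^bsub>IS n\<^esub> carrier (IS n) = b <#\<^bsub>IS n\<^esub> carrier (IS n)" for a b
  proof -
    have "a \<otimes>\<^bsub>IS n\<^esub> \<one>\<^bsub>IS n\<^esub> \<in> a <#\<^bsub>IS n\<^esub> carrier (IS n)"
      using monoid.one_closed[OF monoid_IS] unfolding l_coset_def by blast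
    then have "a \<in> b <#\<^bsub>IS n\<^esub> carrier (IS n)"
      using that by (simp add: monoid.r_one[OF monoid_IS])
    then obtain s where "a = s \<circ>\<^sub>m b"
      by (auto simp: l_coset_def IS_mult)
    then show ?thesis by (auto simp: map_comp_Some_iff)
  qed
  have "a <#\<^bsub>IS n\<^esub> carrier (IS n) = b <#\<^bsub>IS n\<^esub> carrier (IS n) \<longleftrightarrow> dom a = dom b"
    if "a \<in> carrier (IS n)" "b \<in> carrier (IS n)" for a b
    using *[OF that(1)] *[OF that(2)] IS_dom_eqD[OF that] IS_dom_eqD[OF that(2,1)]
    by (metis subset_antisym)
  then show ?thesis
    unfolding green_R_def by blast
qed

end

theory Submission
  imports Defs
begin

text \<open>A cross-section \<open>R\<close> contains exactly one partial bijection for each domain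
  \<open>A \<subseteq> {1..n}\<close>, and the semigroup structure of \<open>R\<close> alone determines how its elements act on points.

  Divisibility in \<open>R\<close> is inclusion of domains: for \<open>a, c \<in> R\<close>, some \<open>b \<in> R\<close> satisfies
  \<open>c = ab\<close> if and only if \<open>dom c \<subseteq> dom a\<close>
  (\<open>R_cross_section_right_divisor_iff\<close>). So an element of rank \<open>k\<close> has exactly \<open>2 ^ k\<close> right
  multiples in \<open>R\<close>, and an isomorphism \<open>\<phi>\<close> preserves ranks
  (\<open>iso_cross_sections_card_dom\<close>). In particular, \<open>\<phi>\<close> permutes the elements of rank one. Writing
  \<open>p\<^sub>x\<close> for the element of \<open>R\<^sub>1\<close> with domain \<open>{x}\<close>, this gives a permutation \<open>\<Theta>\<close> of the
  points such that \<open>\<phi> p\<^sub>x\<close> has domain \<open>{\<Theta> x}\<close>.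

  Multiplication by elements of rank one recovers the action: \<open>x\<alpha> = y\<close> if and only if
  \<open>\<alpha> p\<^sub>y = p\<^sub>x\<close> (\<open>R_cross_section_apply_iff\<close>), because \<open>\<alpha> p\<^sub>y\<close> is defined exactly at the points
  that \<open>\<alpha>\<close> sends to \<open>y\<close>. Applying \<open>\<phi>\<close> to this equation shows that \<open>x\<alpha> = y\<close> if and only if
  \<open>(x\<Theta>)\<phi>(\<alpha>) = y\<Theta>\<close>.\<close>

section \<open>Cross-sections are indexed by domains\<close>

lemma R_cross_section_memD:
  assumes "R_cross_section R (IS n)" and "a \<in> R"
  shows "dom a \<subseteq> {1..n}" "ran a \<subseteq> {1..n}" "inj_on a (dom a)"
proof -
  have "a \<in> carrier (IS n)"
    using assms by (auto simp: R_cross_section_def subsemigroup_def)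
  then show "dom a \<subseteq> {1..n}" "ran a \<subseteq> {1..n}" "inj_on a (dom a)"
    by (auto simp: IS_carrier_iff)
qed

lemma R_cross_section_mult_closed:
  assumes "R_cross_section R (IS n)" and "a \<in> R" and "b \<in> R"
  shows "b \<circ>\<^sub>m a \<in> R"
  using assms by (auto simp: R_cross_section_def subsemigroup_def IS_mult)

text \<open>Each domain occurs in the semigroup as that of a partial identity, so the
  \<open>\<R>\<close>-classes are indexed by all subsets of \<open>{1..n}\<close>.\<close>

lemma R_cross_section_ex1_dom:
  assumes R: "R_cross_section R (IS n)" and A: "A \<subseteq> {1..n}"
  shows "\<exists>!a. a \<in> R \<and> dom a = A"
proof -
  define e where "e x = (if x \<in> A then Some x else None)" for x
  have dom_e: "dom e = A"
    by (auto simp: e_def split: if_splits)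
  have e: "e \<in> carrier (IS n)"
    using A unfolding IS_carrier_iff dom_e
    by (auto simp: e_def ran_def inj_on_def split: if_splits)
  have "green_R (IS n) `` {e} \<in> carrier (IS n) // green_R (IS n)"
    using e by (rule quotientI)
  then have "\<exists>!a. a \<in> R \<inter> green_R (IS n) `` {e}"
    using R unfolding R_cross_section_def by blast
  moreover have "a \<in> R \<inter> green_R (IS n) `` {e} \<longleftrightarrow> a \<in> R \<and> dom a = A" for a
    using R e dom_e by (auto simp: green_R_IS R_cross_section_def subsemigroup_def)
  ultimately show ?thesis by simp
qed

lemma R_cross_section_eqI:
  assumes "R_cross_section R (IS n)" and "a \<in> R" and "b \<in> R" and "dom a = dom b"
  shows "a = b"
  using R_cross_section_ex1_dom[OF assms(1) R_cross_section_memD(1)[OF assms(1,2)]] assms(2-4)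
  by metis

section \<open>Recovering domains and values from the multiplication\<close>

lemma in_dom_map_comp_iff: "x \<in> dom (b \<circ>\<^sub>m a) \<longleftrightarrow> (\<exists>y. a x = Some y \<and> y \<in> dom b)"
  by (auto simp: dom_def map_comp_Some_iff)

text \<open>Any \<open>C \<subseteq> dom a\<close> is cut out of \<open>dom a\<close> by multiplying on the right by the element of
  \<open>R\<close> whose domain is the image of \<open>C\<close> under \<open>a\<close>; the product then agrees with the element of
  \<open>R\<close> with domain \<open>C\<close>, since \<open>R\<close> has only one.\<close>

lemma R_cross_section_right_divisor_iff:
  assumes R: "R_cross_section R (IS n)" and a: "a \<in> R" and c: "c \<in> R"
  shows "(\<exists>b\<in>R. c = b \<circ>\<^sub>m a) \<longleftrightarrow> dom c \<subseteq> dom a"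
proof
  assume "\<exists>b\<in>R. c = b \<circ>\<^sub>m a"
  then obtain b where "c = b \<circ>\<^sub>m a" by blast
  then show "dom c \<subseteq> dom a"
    by (metis in_dom_map_comp_iff domI subsetI)
next
  assume sub: "dom c \<subseteq> dom a"
  let ?B = "{y. \<exists>x\<in>dom c. a x = Some y}"
  have B: "?B \<subseteq> {1..n}"
    using R_cross_section_memD(2)[OF R a] by (auto simp: ran_def)
  then obtain b where b: "b \<in> R" "dom b = ?B"
    using ex1_implies_ex[OF R_cross_section_ex1_dom[OF R B]] by (elim exE conjE)
  have "dom (b \<circ>\<^sub>m a) = dom c"
  proof (intro equalityI subsetI)
    fix x assume "x \<in> dom (b \<circ>\<^sub>m a)"
    then obtain y where y: "a x = Some y" "y \<in> dom b"
      by (auto simp: in_dom_map_comp_iff)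
    then obtain x' where x': "x' \<in> dom c" "a x' = Some y"
      using b(2) by auto
    then have "x' = x"
      using y(1) inj_onD[OF R_cross_section_memD(3)[OF R a], of x' x] by (simp add: domI)
    then show "x \<in> dom c" using x'(1) by simp
  next
    fix x assume x: "x \<in> dom c"
    then obtain y where y: "a x = Some y" using sub by auto
    then have "y \<in> dom b" using b(2) x by auto
    then show "x \<in> dom (b \<circ>\<^sub>m a)" using y by (auto simp: in_dom_map_comp_iff)
  qed
  then have "c = b \<circ>\<^sub>m a"
    using R_cross_section_eqI[OF R c R_cross_section_mult_closed[OF R a b(1)]] by simp
  then show "\<exists>b\<in>R. c = b \<circ>\<^sub>m a" using b(1) by blast
qed

lemma R_cross_section_card_below:
  assumes R: "R_cross_section R (IS n)" and a: "a \<in> R"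
  shows "card {c \<in> R. dom c \<subseteq> dom a} = 2 ^ card (dom a)"
proof -
  have fin: "finite (dom a)"
    using R_cross_section_memD(1)[OF R a] by (rule finite_subset) simp
  have "bij_betw dom {c \<in> R. dom c \<subseteq> dom a} (Pow (dom a))"
  proof (rule bij_betwI')
    fix C assume C: "C \<in> Pow (dom a)"
    then have "C \<subseteq> {1..n}" using R_cross_section_memD(1)[OF R a] by auto
    from ex1_implies_ex[OF R_cross_section_ex1_dom[OF R this]]
    obtain c where "c \<in> R" "dom c = C" by (elim exE conjE)
    then show "\<exists>c\<in>{c \<in> R. dom c \<subseteq> dom a}. C = dom c"
      using C by auto
  next
    fix c d assume "c \<in> {c \<in> R. dom c \<subseteq> dom a}" and "d \<in> {c \<in> R. dom c \<subseteq> dom a}"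
    then show "dom c = dom d \<longleftrightarrow> c = d"
      using R_cross_section_eqI[OF R] by blast
  qed blast
  then show ?thesis
    using card_Pow[OF fin] by (simp add: bij_betw_same_card)
qed

text \<open>The product \<open>q \<circ>\<^sub>m a\<close> is defined exactly where \<open>a\<close> takes the value \<open>y\<close>. By injectivity
  this is at most one point, and the product is then determined by that point.\<close>

lemma R_cross_section_apply_iff:
  assumes R: "R_cross_section R (IS n)" and a: "a \<in> R"
    and p: "p \<in> R" "dom p = {x}" and q: "q \<in> R" "dom q = {y}"
  shows "a x = Some y \<longleftrightarrow> q \<circ>\<^sub>m a = p"
proof
  assume ax: "a x = Some y"
  have "dom (q \<circ>\<^sub>m a) = {x}"
  proof (intro equalityI subsetI)
    fix u assume "u \<in> dom (q \<circ>\<^sub>m a)"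
    then have "a u = Some y"
      using q(2) by (auto simp: in_dom_map_comp_iff)
    then show "u \<in> {x}"
      using ax inj_onD[OF R_cross_section_memD(3)[OF R a], of u x] by (simp add: domI)
  next
    fix u assume "u \<in> {x}"
    moreover have "y \<in> dom q" using q(2) by simp
    ultimately show "u \<in> dom (q \<circ>\<^sub>m a)"
      using ax by (auto simp: in_dom_map_comp_iff)
  qed
  then show "q \<circ>\<^sub>m a = p"
    using R_cross_section_eqI[OF R R_cross_section_mult_closed[OF R a q(1)] p(1)] p(2) by simp
next
  assume "q \<circ>\<^sub>m a = p"
  then have "x \<in> dom (q \<circ>\<^sub>m a)" using p(2) by simp
  then show "a x = Some y"
    using q(2) by (auto simp: in_dom_map_comp_iff)
qed

section \<open>Isomorphisms between cross-sections\<close>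

lemma iso_cross_sections_iff:
  "\<phi> \<in> iso ((IS n)\<lparr>carrier := R1\<rparr>) ((IS n)\<lparr>carrier := R2\<rparr>) \<longleftrightarrow>
     bij_betw \<phi> R1 R2 \<and> (\<forall>a\<in>R1. \<forall>b\<in>R1. \<phi> (b \<circ>\<^sub>m a) = \<phi> b \<circ>\<^sub>m \<phi> a)"
  by (auto simp: iso_def hom_def IS_mult bij_betw_def)

text \<open>Divisibility is preserved, and it determines inclusion of domains; counting the elements
  below \<open>a\<close> then yields its rank.\<close>

lemma iso_cross_sections_card_dom:
  assumes R1: "R_cross_section R1 (IS n)" and R2: "R_cross_section R2 (IS n)"
    and iso: "\<phi> \<in> iso ((IS n)\<lparr>carrier := R1\<rparr>) ((IS n)\<lparr>carrier := R2\<rparr>)"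
    and a: "a \<in> R1"
  shows "card (dom (\<phi> a)) = card (dom a)"
proof -
  have inj: "inj_on \<phi> R1" and img: "\<phi> ` R1 = R2"
    using iso by (auto simp: iso_cross_sections_iff bij_betw_def)
  have hom: "\<phi> (b \<circ>\<^sub>m a) = \<phi> b \<circ>\<^sub>m \<phi> a" if "b \<in> R1" for b
    using iso a that by (simp add: iso_cross_sections_iff)
  have \<phi>a: "\<phi> a \<in> R2" using a img by blast
  have "dom (\<phi> c) \<subseteq> dom (\<phi> a) \<longleftrightarrow> dom c \<subseteq> dom a" if c: "c \<in> R1" for c
  proof -
    have \<phi>c: "\<phi> c \<in> R2" using c img by blast
    have "(\<exists>b\<in>R2. \<phi> c = b \<circ>\<^sub>m \<phi> a) \<longleftrightarrow> (\<exists>b\<in>R1. \<phi> c = \<phi> (b \<circ>\<^sub>m a))"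
      unfolding img[symmetric] using hom by auto
    also have "\<dots> \<longleftrightarrow> (\<exists>b\<in>R1. c = b \<circ>\<^sub>m a)"
      using inj_on_eq_iff[OF inj c R_cross_section_mult_closed[OF R1 a]] by auto
    finally show ?thesis
      unfolding R_cross_section_right_divisor_iff[OF R1 a c]
        R_cross_section_right_divisor_iff[OF R2 \<phi>a \<phi>c] .
  qed
  then have "{d \<in> R2. dom d \<subseteq> dom (\<phi> a)} = \<phi> ` {c \<in> R1. dom c \<subseteq> dom a}"
    unfolding img[symmetric] by auto
  moreover have "inj_on \<phi> {c \<in> R1. dom c \<subseteq> dom a}"
    using inj by (rule inj_on_subset) auto
  ultimately have "card {d \<in> R2. dom d \<subseteq> dom (\<phi> a)} = card {c \<in> R1. dom c \<subseteq> dom a}"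
    by (simp add: card_image)
  then have "(2::nat) ^ card (dom (\<phi> a)) = 2 ^ card (dom a)"
    unfolding R_cross_section_card_below[OF R1 a] R_cross_section_card_below[OF R2 \<phi>a] .
  then show ?thesis by simp
qed

theorem theorem3:
  fixes n :: nat and R1 R2 :: "(nat \<rightharpoonup> nat) set" and \<phi> :: "(nat \<rightharpoonup> nat) \<Rightarrow> (nat \<rightharpoonup> nat)"
  assumes "n \<ge> 1"
    and "R_cross_section R1 (IS n)" and "R_cross_section R2 (IS n)"
    and "\<phi> \<in> iso ((IS n)\<lparr>carrier := R1\<rparr>) ((IS n)\<lparr>carrier := R2\<rparr>)"
  shows "\<exists>\<Theta>. \<Theta> permutes {1..n} \<and>
           (\<forall>\<alpha>\<in>R1. \<forall>x\<in>{1..n}. map_option \<Theta> (\<alpha> x) = \<phi> \<alpha> (\<Theta> x))"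
proof -
  note R1 = assms(2) and R2 = assms(3)
  have bij: "bij_betw \<phi> R1 R2"
    and hom: "\<And>a b. a \<in> R1 \<Longrightarrow> b \<in> R1 \<Longrightarrow> \<phi> (b \<circ>\<^sub>m a) = \<phi> b \<circ>\<^sub>m \<phi> a"
    using assms(4) by (auto simp: iso_cross_sections_iff)
  have inj: "inj_on \<phi> R1" and \<phi>R: "\<And>a. a \<in> R1 \<Longrightarrow> \<phi> a \<in> R2"
    using bij by (auto simp: bij_betw_def)
  have "\<exists>p. p \<in> R1 \<and> dom p = {x}" if "x \<in> {1..n}" for x
    using R_cross_section_ex1_dom[OF R1, of "{x}"] that by blast
  then obtain p where p: "\<And>x. x \<in> {1..n} \<Longrightarrow> p x \<in> R1 \<and> dom (p x) = {x}"
    by metis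
  have "\<exists>y. dom (\<phi> (p x)) = {y}" if x: "x \<in> {1..n}" for x
    using iso_cross_sections_card_dom[OF R1 R2 assms(4), of "p x"] p[OF x]
    by (simp add: card_1_singleton_iff)
  then obtain t where t: "\<And>x. x \<in> {1..n} \<Longrightarrow> dom (\<phi> (p x)) = {t x}"
    by metis
  define \<Theta> where "\<Theta> x = (if x \<in> {1..n} then t x else x)" for x
  have dom_\<phi>p: "dom (\<phi> (p x)) = {\<Theta> x}" if "x \<in> {1..n}" for x
    using t[OF that] that by (simp add: \<Theta>_def)
  have \<phi>p: "\<phi> (p x) \<in> R2" if "x \<in> {1..n}" for x
    using \<phi>R p that by blast
  have inj_\<Theta>: "inj_on \<Theta> {1..n}"
  proof (rule inj_onI)
    fix x y assume x: "x \<in> {1..n}" and y: "y \<in> {1..n}" and eq: "\<Theta> x = \<Theta> y"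
    have *: "\<phi> (p x) = \<phi> (p y)"
      using R_cross_section_eqI[OF R2 \<phi>p[OF x] \<phi>p[OF y]] dom_\<phi>p[OF x] dom_\<phi>p[OF y] eq by simp
    have "p x = p y"
      by (rule inj_onD[OF inj, where x = "p x" and y = "p y"]) (use * p x y in blast)+
    then have "dom (p x) = dom (p y)" by (rule arg_cong)
    then have "{x} = {y}"
      unfolding conjunct2[OF p[OF x]] conjunct2[OF p[OF y]] .
    then show "x = y" by simp
  qed
  have "\<Theta> x \<in> {1..n}" if "x \<in> {1..n}" for x
    using R_cross_section_memD(1)[OF R2 \<phi>p[OF that]] unfolding dom_\<phi>p[OF that] by blast
  then have "\<Theta> ` {1..n} \<subseteq> {1..n}" by blast
  then have img_\<Theta>: "\<Theta> ` {1..n} = {1..n}"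
    using inj_\<Theta> by (intro endo_inj_surj) auto
  have perm: "\<Theta> permutes {1..n}"
    using inj_\<Theta> img_\<Theta> by (intro bij_imp_permutes) (auto simp: bij_betw_def \<Theta>_def)
  have key: "\<alpha> x = Some y \<longleftrightarrow> \<phi> \<alpha> (\<Theta> x) = Some (\<Theta> y)"
    if \<alpha>: "\<alpha> \<in> R1" and x: "x \<in> {1..n}" and y: "y \<in> {1..n}" for \<alpha> x y
  proof -
    have "\<alpha> x = Some y \<longleftrightarrow> p y \<circ>\<^sub>m \<alpha> = p x"
      using R_cross_section_apply_iff[OF R1 \<alpha>, of "p x" x "p y" y] p[OF x] p[OF y] by simp
    also have "\<dots> \<longleftrightarrow> \<phi> (p y \<circ>\<^sub>m \<alpha>) = \<phi> (p x)"
      using inj_on_eq_iff[OF inj, of "p y \<circ>\<^sub>m \<alpha>" "p x"]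
        R_cross_section_mult_closed[OF R1 \<alpha>, of "p y"] p[OF x] p[OF y] by simp
    also have "\<dots> \<longleftrightarrow> \<phi> (p y) \<circ>\<^sub>m \<phi> \<alpha> = \<phi> (p x)"
      using hom[OF \<alpha>, of "p y"] p[OF y] by simp
    also have "\<dots> \<longleftrightarrow> \<phi> \<alpha> (\<Theta> x) = Some (\<Theta> y)"
      using R_cross_section_apply_iff[OF R2 \<phi>R[OF \<alpha>] \<phi>p[OF x] dom_\<phi>p[OF x] \<phi>p[OF y] dom_\<phi>p[OF y]]
      by simp
    finally show ?thesis .
  qed
  have "map_option \<Theta> (\<alpha> x) = \<phi> \<alpha> (\<Theta> x)" if \<alpha>: "\<alpha> \<in> R1" and x: "x \<in> {1..n}" for \<alpha> x
  proof (cases "\<alpha> x")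
    case (Some y)
    then have "y \<in> {1..n}"
      using R_cross_section_memD(2)[OF R1 \<alpha>] by (auto simp: ran_def)
    then have "\<phi> \<alpha> (\<Theta> x) = Some (\<Theta> y)"
      using key[OF \<alpha> x] Some by blast
    then show ?thesis using Some by simp
  next
    case None
    have "\<phi> \<alpha> (\<Theta> x) = None"
    proof (rule ccontr)
      assume "\<phi> \<alpha> (\<Theta> x) \<noteq> None"
      then obtain z where z: "\<phi> \<alpha> (\<Theta> x) = Some z" by blast
      then have "z \<in> {1..n}"
        using R_cross_section_memD(2)[OF R2 \<phi>R[OF \<alpha>]] by (auto simp: ran_def)
      then obtain y where "y \<in> {1..n}" "z = \<Theta> y"
        using img_\<Theta> by blast
      then show False using key[OF \<alpha> x, of y] z None by simp
    qed
    then show ?thesis using None by simp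
  qed
  then show ?thesis using perm by blast
qed

end
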